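(* Let $\mathcal C$ be a class of groups satisfying the following two properties: (P1) every subgroup of any finitely generated right-angled Artin group is in $\mathcal C$; (P2) if $B$ is a group that has a normal subgroup $A\in\mathcal C$ such that $B/A\in\mathcal C$, then $B\in\mathcal C$. Let $\Gamma$ be a finite simplicial graph and let $G_\Gamma$ be the graph product of countable groups $\{G_i\}_{i\in V(\Gamma)}$. If each $G_i\in\mathcal C$, then $G_\Gamma\in\mathcal C$.
   Context: Classes of groups are understood to be closed under isomorphism. The graph product $G_\Gamma$ of groups $\{G_i\}_{i\in V(\Gamma)}$ is the quotient of the free product of the $G_i$ by the relations $[g_i,g_j]=1$ for all $g_i\in G_i$, $g_j\in G_j$ whenever $\{i,j\}$ is an edge of $\Gamma$. A right-angled Artin group is a graph product all of whose vertex groups are $\mathbb Z$. *)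

theory Defs
  imports "HOL-Algebra.Elementary_Groups" "HOL-Library.Countable_Set"
begin

definition simplicial_graph :: "'v set \<Rightarrow> 'v set set \<Rightarrow> bool" where
  "simplicial_graph V E \<longleftrightarrow> (\<forall>e\<in>E. e \<subseteq> V \<and> card e = 2)"

definition finitely_generated :: "('a, 'm) monoid_scheme \<Rightarrow> bool" where
  "finitely_generated G \<longleftrightarrow> (\<exists>S. finite S \<and> S \<subseteq> carrier G \<and> generate G S = carrier G)"

definition normal_closure :: "('a, 'm) monoid_scheme \<Rightarrow> 'a set \<Rightarrow> 'a set" where
  "normal_closure G S = \<Inter> {N. N \<lhd> G \<and> S \<subseteq> N}"

definition free_product_words :: "'v set \<Rightarrow> ('v \<Rightarrow> 'g monoid) \<Rightarrow> ('v \<times> 'g) list set" where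
  "free_product_words V G = lists (SIGMA i:V. carrier (G i))"

text \<open>The congruence on words, under concatenation, generated by deleting identity letters
  and by multiplying adjacent letters that come from the same factor.\<close>

inductive_set free_product_rel ::
  "'v set \<Rightarrow> ('v \<Rightarrow> 'g monoid) \<Rightarrow> (('v \<times> 'g) list \<times> ('v \<times> 'g) list) set"
  for V :: "'v set" and G :: "'v \<Rightarrow> 'g monoid" where
  unit: "\<lbrakk>u \<in> free_product_words V G; v \<in> free_product_words V G; i \<in> V\<rbrakk> \<Longrightarrow>
    (u @ [(i, \<one>\<^bsub>G i\<^esub>)] @ v, u @ v) \<in> free_product_rel V G"
| mult: "\<lbrakk>u \<in> free_product_words V G; v \<in> free_product_words V G; i \<in> V;
    g \<in> carrier (G i); h \<in> carrier (G i)\<rbrakk> \<Longrightarrow>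
    (u @ [(i, g), (i, h)] @ v, u @ [(i, g \<otimes>\<^bsub>G i\<^esub> h)] @ v) \<in> free_product_rel V G"
| refl: "u \<in> free_product_words V G \<Longrightarrow> (u, u) \<in> free_product_rel V G"
| sym: "(u, v) \<in> free_product_rel V G \<Longrightarrow> (v, u) \<in> free_product_rel V G"
| trans: "\<lbrakk>(u, v) \<in> free_product_rel V G; (v, w) \<in> free_product_rel V G\<rbrakk> \<Longrightarrow>
    (u, w) \<in> free_product_rel V G"

definition free_product :: "'v set \<Rightarrow> ('v \<Rightarrow> 'g monoid) \<Rightarrow> ('v \<times> 'g) list set monoid" where
  "free_product V G =
    \<lparr>carrier = free_product_words V G // free_product_rel V G,
     monoid.mult = (\<lambda>P Q. \<Union>x\<in>P. \<Union>y\<in>Q. free_product_rel V G `` {x @ y}),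
     one = free_product_rel V G `` {[]}\<rparr>"

definition free_product_incl ::
  "'v set \<Rightarrow> ('v \<Rightarrow> 'g monoid) \<Rightarrow> 'v \<Rightarrow> 'g \<Rightarrow> ('v \<times> 'g) list set" where
  "free_product_incl V G i g = free_product_rel V G `` {[(i, g)]}"

definition commutator :: "('a, 'm) monoid_scheme \<Rightarrow> 'a \<Rightarrow> 'a \<Rightarrow> 'a" where
  "commutator G x y = x \<otimes>\<^bsub>G\<^esub> y \<otimes>\<^bsub>G\<^esub> inv\<^bsub>G\<^esub> x \<otimes>\<^bsub>G\<^esub> inv\<^bsub>G\<^esub> y"

definition graph_product_relators ::
  "'v set \<Rightarrow> 'v set set \<Rightarrow> ('v \<Rightarrow> 'g monoid) \<Rightarrow> ('v \<times> 'g) list set set" where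
  "graph_product_relators V E G =
    {commutator (free_product V G) (free_product_incl V G i g) (free_product_incl V G j h) | i j g h.
      i \<in> V \<and> j \<in> V \<and> {i, j} \<in> E \<and> g \<in> carrier (G i) \<and> h \<in> carrier (G j)}"

definition graph_product ::
  "'v set \<Rightarrow> 'v set set \<Rightarrow> ('v \<Rightarrow> 'g monoid) \<Rightarrow> ('v \<times> 'g) list set set monoid" where
  "graph_product V E G =
    free_product V G Mod normal_closure (free_product V G) (graph_product_relators V E G)"

definition right_angled_Artin_group ::
  "'v set \<Rightarrow> 'v set set \<Rightarrow> ('v \<times> int) list set set monoid" where
  "right_angled_Artin_group V E = graph_product V E (\<lambda>_. integer_group)"

text \<open>HOL has no predicates ranging over groups of all types at once. A class of groups is
  therefore a predicate, closed under isomorphism, on the groups with elements in a type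
  \<open>'u\<close>, which is left arbitrary. A group with elements in another type belongs to
  the class if it is isomorphic to a member.\<close>

definition group_class :: "('u monoid \<Rightarrow> bool) \<Rightarrow> bool" where
  "group_class \<C> \<longleftrightarrow>
    (\<forall>G. \<C> G \<longrightarrow> group G) \<and> (\<forall>G H. \<C> G \<and> group H \<and> G \<cong> H \<longrightarrow> \<C> H)"

definition in_class :: "'b monoid \<Rightarrow> ('u monoid \<Rightarrow> bool) \<Rightarrow> bool" where
  "in_class G \<C> \<longleftrightarrow> group G \<and> (\<exists>H. \<C> H \<and> G \<cong> H)"

text \<open>A finitely generated right-angled Artin group has finitely many vertices, so
  graphs whose vertices are natural numbers give all of them up to isomorphism.\<close>

definition contains_subgroups_of_RAAGs :: "('u monoid \<Rightarrow> bool) \<Rightarrow> bool" where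
  "contains_subgroups_of_RAAGs \<C> \<longleftrightarrow>
    (\<forall>(V :: nat set) E H. simplicial_graph V E \<and>
      finitely_generated (right_angled_Artin_group V E) \<and>
      subgroup H (right_angled_Artin_group V E) \<longrightarrow>
      in_class ((right_angled_Artin_group V E)\<lparr>carrier := H\<rparr>) \<C>)"

definition closed_under_extensions :: "('u monoid \<Rightarrow> bool) \<Rightarrow> bool" where
  "closed_under_extensions \<C> \<longleftrightarrow>
    (\<forall>(B :: 'u monoid) A. group B \<and> A \<lhd> B \<and> in_class (B\<lparr>carrier := A\<rparr>) \<C> \<and>
      in_class (B Mod A) \<C> \<longrightarrow> in_class B \<C>)"

end

theory Submission
  imports Defs "HOL-Algebra.Bij" "HOL-Algebra.Product_Groups" "HOL-Algebra.Weak_Morphisms"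
begin

text \<open>
  Let \<open>P\<close> be the direct product of the vertex groups and \<open>B\<close> the right-angled Artin group of the
  graph, with standard generators \<open>x\<^sub>i\<close>. The retractions of the graph product onto its vertex
  groups combine to a surjection onto \<open>P\<close>. As \<open>P\<close> is a finite iterated extension of the vertex
  groups, it lies in the class (\<open>finite_product_in_class\<close>), and it remains to see that the
  kernel \<open>K\<close> of the surjection lies in the class. For this \<open>K\<close> is embedded into \<open>B\<close>.

  Choose injections \<open>n\<^sub>i\<close> from the countable groups \<open>G\<^sub>i\<close> to the integers, and let
  \<open>g \<in> G\<^sub>i\<close> act on \<open>B \<times> P\<close> by
  \<open>(b, p) \<mapsto> (x\<^sub>i ^ (n\<^sub>i (g p\<^sub>i) - n\<^sub>i (p\<^sub>i)) b, p(i := g p\<^sub>i))\<close>.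
  The exponents telescope, so this is an action of \<open>G\<^sub>i\<close>. The actions of adjacent vertex groups
  commute because their generators do, so together they give an action of the graph product.
  An element of \<open>K\<close> sends \<open>(b, 1)\<close> to \<open>(c b, 1)\<close> for some \<open>c\<close> in \<open>B\<close> independent of \<open>b\<close>,
  and mapping it to \<open>c\<close> is a homomorphism from \<open>K\<close> to \<open>B\<close>.

  This homomorphism is injective (\<open>cocycle_inj\<close>). A shortest word for an element of the graph
  product is reduced: no letter is trivial, and no letter can be moved next to another one from the
  same vertex group (\<open>shorten_unreduced\<close>). Since \<open>n\<^sub>i\<close> is injective, a nontrivial letter
  contributes a nonzero power of \<open>x\<^sub>i\<close>. Hence a reduced word is sent to a word in the \<open>x\<^sub>i\<close>
  that is reduced over the same graph, and such a word is nontrivial in \<open>B\<close> unless it is empty.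
  The last fact is shown by letting \<open>B\<close> act on heaps of pieces, called pilings here, on
  which a reduced word just drops its letters one after the other (\<open>pile_reduced\<close>).

  A point of types remains. The class consists of groups with elements in a fixed type, and so does
  its closure under extensions. That type is infinite because the class contains the integers
  (\<open>infinite_type_of_RAAG_class\<close>), so every countable group has a copy in it, and extensions
  that are countable groups of any type can be used (\<open>extension_in_class\<close>).
\<close>

section \<open>Graph products by words\<close>

locale vertex_groups =
  fixes V :: "'v set" and E :: "'v set set" and G :: "'v \<Rightarrow> 'g monoid"
  assumes vertex_group: "i \<in> V \<Longrightarrow> group (G i)"
begin

abbreviation words :: "('v \<times> 'g) list set" where
  "words \<equiv> free_product_words V G"

abbreviation rel :: "(('v \<times> 'g) list \<times> ('v \<times> 'g) list) set" where
  "rel \<equiv> free_product_rel V G"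

abbreviation FP :: "('v \<times> 'g) list set monoid" where
  "FP \<equiv> free_product V G"

abbreviation GP :: "('v \<times> 'g) list set set monoid" where
  "GP \<equiv> graph_product V E G"

abbreviation relators_closure :: "('v \<times> 'g) list set set" where
  "relators_closure \<equiv> normal_closure FP (graph_product_relators V E G)"

definition fclass :: "('v \<times> 'g) list \<Rightarrow> ('v \<times> 'g) list set" where
  "fclass w = rel `` {w}"

text \<open>The carrier of the graph product consists of cosets of classes of words. All later arguments
  name its elements by words through the following map.\<close>

definition gclass :: "('v \<times> 'g) list \<Rightarrow> ('v \<times> 'g) list set set" where
  "gclass w = relators_closure #>\<^bsub>FP\<^esub> fclass w"

lemma Nil_words [simp]: "[] \<in> words"
  by (simp add: free_product_words_def)

lemma Cons_words [simp]: "(i, g) # w \<in> words \<longleftrightarrow> i \<in> V \<and> g \<in> carrier (G i) \<and> w \<in> words"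
  by (auto simp: free_product_words_def)

lemma append_words [simp]: "u @ w \<in> words \<longleftrightarrow> u \<in> words \<and> w \<in> words"
  by (auto simp: free_product_words_def)

lemma rel_words: "(u, w) \<in> rel \<Longrightarrow> u \<in> words \<and> w \<in> words"
  by (induction rule: free_product_rel.induct)
    (auto simp: vertex_group group.is_monoid monoid.m_closed)

lemma equiv_rel: "equiv words rel"
proof (rule equivI)
  show "rel \<subseteq> words \<times> words" using rel_words by auto
  show "refl_on words rel" by (auto simp: refl_on_def intro: free_product_rel.refl)
  show "sym_on UNIV rel" by (auto intro: symI free_product_rel.sym)
  show "trans_on UNIV rel" by (rule transI) (rule free_product_rel.trans)
qed

lemma rel_append_left: "(u, w) \<in> rel \<Longrightarrow> x \<in> words \<Longrightarrow> (x @ u, x @ w) \<in> rel"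
proof (induction rule: free_product_rel.induct)
  case (unit u v i)
  then show ?case using free_product_rel.unit[of "x @ u" V G v i] by simp
next
  case (mult u v i g h)
  then show ?case using free_product_rel.mult[of "x @ u" V G v i g h] by simp
next
  case (refl u) then show ?case by (simp add: free_product_rel.refl)
next
  case (sym u v) then show ?case by (simp add: free_product_rel.sym)
next
  case (trans u v w) then show ?case by (meson free_product_rel.trans)
qed

lemma rel_append_right: "(u, w) \<in> rel \<Longrightarrow> x \<in> words \<Longrightarrow> (u @ x, w @ x) \<in> rel"
proof (induction rule: free_product_rel.induct)
  case (unit u v i)
  then show ?case using free_product_rel.unit[of u V G "v @ x" i] by simp
next
  case (mult u v i g h)
  then show ?case using free_product_rel.mult[of u V G "v @ x" i g h] by simp
next
  case (refl u) then show ?case by (simp add: free_product_rel.refl)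
next
  case (sym u v) then show ?case by (simp add: free_product_rel.sym)
next
  case (trans u v w) then show ?case by (meson free_product_rel.trans)
qed

lemma rel_append: "(u, u') \<in> rel \<Longrightarrow> (w, w') \<in> rel \<Longrightarrow> (u @ w, u' @ w') \<in> rel"
  by (meson free_product_rel.trans rel_append_left rel_append_right rel_words)

lemma fclass_eq_iff: "u \<in> words \<Longrightarrow> w \<in> words \<Longrightarrow> fclass u = fclass w \<longleftrightarrow> (u, w) \<in> rel"
  by (simp add: fclass_def eq_equiv_class_iff[OF equiv_rel])

lemma carrier_FP: "carrier FP = fclass ` words"
  by (auto simp: free_product_def fclass_def quotient_def)

lemma fclass_closed: "w \<in> words \<Longrightarrow> fclass w \<in> carrier FP"
  by (simp add: carrier_FP)

lemma fclass_mult: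
  assumes "u \<in> words" "w \<in> words"
  shows "fclass u \<otimes>\<^bsub>FP\<^esub> fclass w = fclass (u @ w)"
proof -
  have "rel `` {x @ y} = fclass (u @ w)" if "x \<in> fclass u" "y \<in> fclass w" for x y
  proof -
    have "(u, x) \<in> rel" "(w, y) \<in> rel" using that by (auto simp: fclass_def)
    then have "(u @ w, x @ y) \<in> rel" by (rule rel_append)
    then show ?thesis
      using equiv_class_eq[OF equiv_rel] by (metis fclass_def)
  qed
  moreover have "u \<in> fclass u" "w \<in> fclass w"
    using assms by (auto simp: fclass_def intro: free_product_rel.refl)
  ultimately show ?thesis
    by (auto simp: free_product_def)
qed

lemma one_FP: "\<one>\<^bsub>FP\<^esub> = fclass []"
  by (simp add: free_product_def fclass_def)

lemma fclass_unit: "i \<in> V \<Longrightarrow> fclass [(i, \<one>\<^bsub>G i\<^esub>)] = fclass []"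
  using free_product_rel.unit[of "[]" V G "[]" i] rel_words fclass_eq_iff by fastforce

lemma fclass_merge:
  assumes "i \<in> V" "g \<in> carrier (G i)" "h \<in> carrier (G i)"
  shows "fclass [(i, g), (i, h)] = fclass [(i, g \<otimes>\<^bsub>G i\<^esub> h)]"
  using free_product_rel.mult[of "[]" V G "[]" i g h] assms rel_words fclass_eq_iff by fastforce

lemma group_FP: "group FP"
proof (rule groupI)
  fix x y z assume "x \<in> carrier FP" "y \<in> carrier FP" "z \<in> carrier FP"
  then show "x \<otimes>\<^bsub>FP\<^esub> y \<otimes>\<^bsub>FP\<^esub> z = x \<otimes>\<^bsub>FP\<^esub> (y \<otimes>\<^bsub>FP\<^esub> z)"
    by (auto simp: carrier_FP fclass_mult)
next
  fix x assume "x \<in> carrier FP"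
  then obtain w where w: "w \<in> words" "x = fclass w" by (auto simp: carrier_FP)
  have "\<exists>w'\<in>words. fclass (w' @ w) = fclass []" using w(1)
  proof (induction w)
    case Nil
    then show ?case by (intro bexI[of _ "[]"]) auto
  next
    case (Cons l w)
    obtain i g where l: "l = (i, g)" by (cases l)
    interpret Gi: group "G i" using Cons.prems l vertex_group by simp
    have i: "i \<in> V" "g \<in> carrier (G i)" "w \<in> words" using Cons.prems l by auto
    obtain w' where w': "w' \<in> words" "fclass (w' @ w) = fclass []" using Cons.IH i by auto
    let ?l' = "(i, inv\<^bsub>G i\<^esub> g)"
    have "fclass ([?l', (i, g)]) = fclass []"
      using fclass_merge[of i "inv\<^bsub>G i\<^esub> g" g] fclass_unit[of i] i by simp
    then have "fclass (w' @ [?l', (i, g)] @ w) = fclass (w' @ [] @ w)"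
      using i w' by (metis Cons_words Nil_words append_words fclass_mult Gi.inv_closed)
    then show ?case using w' i l by (intro bexI[of _ "w' @ [?l']"]) auto
  qed
  then show "\<exists>y\<in>carrier FP. y \<otimes>\<^bsub>FP\<^esub> x = \<one>\<^bsub>FP\<^esub>"
    using w by (auto simp: carrier_FP fclass_mult one_FP)
qed (auto simp: carrier_FP fclass_mult one_FP)

lemma relators_closed: "graph_product_relators V E G \<subseteq> carrier FP"
proof -
  interpret group FP by (rule group_FP)
  show ?thesis
    unfolding graph_product_relators_def commutator_def free_product_incl_def fclass_def[symmetric]
    using fclass_closed by auto
qed

lemma normal_relators_closure: "relators_closure \<lhd> FP"
proof -
  interpret group FP by (rule group_FP)
  let ?S = "{N. N \<lhd> FP \<and> graph_product_relators V E G \<subseteq> N}"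
  have S: "carrier FP \<in> ?S"
    using relators_closed by (simp add: normal_inv_iff subgroup_self)
  have "subgroup (\<Inter> ?S) FP"
    using S by (intro subgroups_Inter) (auto simp: normal_imp_subgroup)
  moreover have "x \<otimes>\<^bsub>FP\<^esub> h \<otimes>\<^bsub>FP\<^esub> inv\<^bsub>FP\<^esub> x \<in> N"
    if "x \<in> carrier FP" "h \<in> \<Inter> ?S" "N \<in> ?S" for x h N
    using that by (auto simp: normal_inv_iff)
  ultimately show ?thesis
    unfolding normal_closure_def by (subst normal_inv_iff) auto
qed

lemma group_GP: "group GP"
  unfolding graph_product_def by (rule normal.factorgroup_is_group[OF normal_relators_closure])

lemma carrier_GP: "carrier GP = gclass ` words"
  by (auto simp: graph_product_def FactGroup_def RCOSETS_def gclass_def carrier_FP)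

lemma gclass_mult:
  assumes "u \<in> words" "w \<in> words"
  shows "gclass u \<otimes>\<^bsub>GP\<^esub> gclass w = gclass (u @ w)"
  using assms normal.rcos_sum[OF normal_relators_closure, of "fclass u" "fclass w"]
  by (simp add: graph_product_def FactGroup_def gclass_def carrier_FP fclass_mult)

lemma one_GP: "\<one>\<^bsub>GP\<^esub> = gclass []"
  using group.coset_mult_one[OF group_FP, of relators_closure]
    normal_imp_subgroup[OF normal_relators_closure] subgroup.subset[of relators_closure FP]
  by (simp add: graph_product_def FactGroup_def gclass_def one_FP)

lemma gclass_closed: "w \<in> words \<Longrightarrow> gclass w \<in> carrier GP"
  by (simp add: carrier_GP)

lemma gclass_unit: "i \<in> V \<Longrightarrow> gclass [(i, \<one>\<^bsub>G i\<^esub>)] = gclass []"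
  by (simp add: gclass_def fclass_unit)

lemma gclass_merge:
  assumes "i \<in> V" "g \<in> carrier (G i)" "h \<in> carrier (G i)"
  shows "gclass [(i, g), (i, h)] = gclass [(i, g \<otimes>\<^bsub>G i\<^esub> h)]"
  by (simp add: gclass_def fclass_merge assms)

text \<open>As \<open>x y = [x, y] (y x)\<close>, the two products lie in the same coset of the normal closure of the
  commutators.\<close>

lemma gclass_swap:
  assumes "{i, j} \<in> E" "i \<in> V" "j \<in> V" "g \<in> carrier (G i)" "h \<in> carrier (G j)"
  shows "gclass [(i, g), (j, h)] = gclass [(j, h), (i, g)]"
proof -
  interpret group FP by (rule group_FP)
  let ?x = "fclass [(i, g)]" and ?y = "fclass [(j, h)]"
  have xy: "?x \<in> carrier FP" "?y \<in> carrier FP" using assms by (auto simp: carrier_FP)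
  have "commutator FP ?x ?y \<in> graph_product_relators V E G"
    using assms unfolding graph_product_relators_def free_product_incl_def fclass_def by blast
  then have "commutator FP ?x ?y \<in> relators_closure"
    by (auto simp: normal_closure_def)
  moreover have "?x \<otimes>\<^bsub>FP\<^esub> ?y = commutator FP ?x ?y \<otimes>\<^bsub>FP\<^esub> (?y \<otimes>\<^bsub>FP\<^esub> ?x)"
    using xy by (simp add: commutator_def m_assoc) (simp add: m_assoc[symmetric])
  ultimately have "?x \<otimes>\<^bsub>FP\<^esub> ?y \<in> relators_closure #>\<^bsub>FP\<^esub> (?y \<otimes>\<^bsub>FP\<^esub> ?x)"
    by (auto simp: r_coset_def)
  then have "relators_closure #>\<^bsub>FP\<^esub> (?y \<otimes>\<^bsub>FP\<^esub> ?x) = relators_closure #>\<^bsub>FP\<^esub> (?x \<otimes>\<^bsub>FP\<^esub> ?y)"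
    using xy normal_relators_closure by (intro repr_independence) (auto simp: normal_imp_subgroup)
  then show ?thesis using assms by (simp add: gclass_def fclass_mult)
qed

definition word_map :: "('t, 'm) monoid_scheme \<Rightarrow> ('v \<Rightarrow> 'g \<Rightarrow> 't) \<Rightarrow> ('v \<times> 'g) list \<Rightarrow> 't" where
  "word_map T f w = foldr (\<lambda>(i, g) t. f i g \<otimes>\<^bsub>T\<^esub> t) w \<one>\<^bsub>T\<^esub>"

lemma word_map_simps [simp]:
  "word_map T f [] = \<one>\<^bsub>T\<^esub>"
  "word_map T f ((i, g) # w) = f i g \<otimes>\<^bsub>T\<^esub> word_map T f w"
  by (simp_all add: word_map_def)

context
  fixes T :: "('t, 'm) monoid_scheme" and f :: "'v \<Rightarrow> 'g \<Rightarrow> 't"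
  assumes T: "group T" and f: "\<And>i. i \<in> V \<Longrightarrow> f i \<in> hom (G i) T"
begin

lemma word_map_closed: "w \<in> words \<Longrightarrow> word_map T f w \<in> carrier T"
proof -
  interpret T: group T by (rule T)
  show "w \<in> words \<Longrightarrow> word_map T f w \<in> carrier T"
    by (induction w) (auto intro!: T.m_closed hom_in_carrier[OF f])
qed

lemma word_map_append:
  "u \<in> words \<Longrightarrow> w \<in> words \<Longrightarrow> word_map T f (u @ w) = word_map T f u \<otimes>\<^bsub>T\<^esub> word_map T f w"
proof -
  interpret T: group T by (rule T)
  show "u \<in> words \<Longrightarrow> w \<in> words \<Longrightarrow> ?thesis"
    by (induction u) (auto simp: word_map_closed T.m_assoc hom_in_carrier[OF f])
qed

lemma word_map_rel: "(u, w) \<in> rel \<Longrightarrow> word_map T f u = word_map T f w"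
proof -
  interpret T: group T by (rule T)
  show "(u, w) \<in> rel \<Longrightarrow> ?thesis"
  proof (induction rule: free_product_rel.induct)
    case (unit u v i)
    then have "f i \<one>\<^bsub>G i\<^esub> = \<one>\<^bsub>T\<^esub>"
      using hom_one[OF f vertex_group T] by simp
    with unit show ?case
      by (simp add: word_map_append word_map_closed group.is_monoid[OF vertex_group])
  next
    case (mult u v i g h)
    then show ?case
      by (simp add: word_map_append word_map_closed hom_mult[OF f] hom_in_carrier[OF f] T.m_assoc
          group.is_monoid[OF vertex_group] monoid.m_closed)
  qed auto
qed

text \<open>The universal property: the map on words respects the free product congruence by
  \<open>word_map_rel\<close>, and commuting images put all relators, hence their normal closure, into the
  kernel of the induced homomorphism on the free product.\<close>

lemma graph_product_universal:
  assumes comm: "\<And>i j g h. {i, j} \<in> E \<Longrightarrow> i \<in> V \<Longrightarrow> j \<in> V \<Longrightarrow> g \<in> carrier (G i) \<Longrightarrow> h \<in> carrier (G j)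
      \<Longrightarrow> f i g \<otimes>\<^bsub>T\<^esub> f j h = f j h \<otimes>\<^bsub>T\<^esub> f i g"
  obtains F where "F \<in> hom GP T" "\<And>w. w \<in> words \<Longrightarrow> F (gclass w) = word_map T f w"
proof -
  interpret T: group T by (rule T)
  interpret FP: group FP by (rule group_FP)
  define F0 where "F0 X = word_map T f (SOME w. w \<in> words \<and> fclass w = X)" for X
  have F0: "F0 (fclass w) = word_map T f w" if "w \<in> words" for w
  proof -
    let ?w = "SOME w'. w' \<in> words \<and> fclass w' = fclass w"
    have "?w \<in> words \<and> fclass ?w = fclass w"
      by (rule someI[where x = w]) (use that in simp)
    then have "(?w, w) \<in> rel"
      using that by (simp add: fclass_eq_iff[symmetric])
    then show ?thesis
      unfolding F0_def by (rule word_map_rel)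
  qed
  have hom: "F0 \<in> hom FP T"
    by (rule homI) (auto simp: carrier_FP F0 word_map_closed fclass_mult word_map_append)
  interpret F0: group_hom FP T F0
    by unfold_locales (rule hom)
  have "F0 (commutator FP (fclass [(i, g)]) (fclass [(j, h)])) = \<one>\<^bsub>T\<^esub>"
    if ij: "{i, j} \<in> E" "i \<in> V" "j \<in> V" "g \<in> carrier (G i)" "h \<in> carrier (G j)" for i j g h
  proof -
    let ?x = "fclass [(i, g)]" and ?y = "fclass [(j, h)]"
    have xy: "?x \<in> carrier FP" "?y \<in> carrier FP" using ij by (auto simp: carrier_FP)
    have fc: "f i g \<in> carrier T" "f j h \<in> carrier T" using ij hom_in_carrier[OF f] by auto
    have im: "F0 ?x = f i g" "F0 ?y = f j h" using ij fc by (simp_all add: F0)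
    have "F0 (commutator FP ?x ?y) = f i g \<otimes>\<^bsub>T\<^esub> f j h \<otimes>\<^bsub>T\<^esub> inv\<^bsub>T\<^esub> f i g \<otimes>\<^bsub>T\<^esub> inv\<^bsub>T\<^esub> f j h"
      using xy im by (simp add: commutator_def)
    also have "\<dots> = \<one>\<^bsub>T\<^esub>"
      using comm[OF ij] fc by (simp add: T.m_assoc)
    finally show ?thesis .
  qed
  then have "graph_product_relators V E G \<subseteq> kernel FP T F0"
    using relators_closed unfolding graph_product_relators_def free_product_incl_def fclass_def[symmetric] kernel_def
    by blast
  then have "relators_closure \<subseteq> kernel FP T F0"
    using F0.normal_kernel unfolding normal_closure_def by blast
  then obtain F where "F \<in> hom (FP Mod relators_closure) T"
      "\<And>x. x \<in> carrier FP \<Longrightarrow> F (relators_closure #>\<^bsub>FP\<^esub> x) = F0 x"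
    using F0.FactGroup_universal_kernel[OF normal_relators_closure] by metis
  then show thesis
    by (intro that[of F]) (auto simp: graph_product_def gclass_def carrier_FP F0)
qed

end

end

section \<open>Actions and reduced words\<close>

context vertex_groups
begin

definition word_action :: "('v \<Rightarrow> 'g \<Rightarrow> 's \<Rightarrow> 's) \<Rightarrow> ('v \<times> 'g) list \<Rightarrow> 's \<Rightarrow> 's" where
  "word_action act w s = foldr (\<lambda>(i, g). act i g) w s"

lemma word_action_simps [simp]:
  "word_action act [] s = s"
  "word_action act ((i, g) # w) s = act i g (word_action act w s)"
  "word_action act (u @ w) s = word_action act u (word_action act w s)"
  by (simp_all add: word_action_def)

text \<open>Actions of the vertex groups in which adjacent ones commute give an action of the graph
  product. This is the universal property for the group of bijections of \<open>S\<close>, in a form that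
  speaks of words only.\<close>

lemma word_action_well_defined:
  assumes closed: "\<And>i g s. i \<in> V \<Longrightarrow> g \<in> carrier (G i) \<Longrightarrow> s \<in> S \<Longrightarrow> act i g s \<in> S"
    and unit: "\<And>i s. i \<in> V \<Longrightarrow> s \<in> S \<Longrightarrow> act i \<one>\<^bsub>G i\<^esub> s = s"
    and mult: "\<And>i g h s. i \<in> V \<Longrightarrow> g \<in> carrier (G i) \<Longrightarrow> h \<in> carrier (G i) \<Longrightarrow> s \<in> S \<Longrightarrow>
      act i g (act i h s) = act i (g \<otimes>\<^bsub>G i\<^esub> h) s"
    and comm: "\<And>i j g h s. {i, j} \<in> E \<Longrightarrow> i \<in> V \<Longrightarrow> j \<in> V \<Longrightarrow> g \<in> carrier (G i) \<Longrightarrow>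
      h \<in> carrier (G j) \<Longrightarrow> s \<in> S \<Longrightarrow> act i g (act j h s) = act j h (act i g s)"
    and uw: "u \<in> words" "w \<in> words" "gclass u = gclass w" and s: "s \<in> S"
  shows "word_action act u s = word_action act w s"
proof -
  interpret T: group "BijGroup S" by (rule group_BijGroup)
  define f where "f i g = restrict (act i g) S" for i g
  have bij: "bij_betw (act i g) S S" if ig: "i \<in> V" "g \<in> carrier (G i)" for i g
  proof -
    interpret Gi: group "G i" using ig vertex_group by simp
    show ?thesis
      by (rule bij_betw_byWitness[where f' = "act i (inv\<^bsub>G i\<^esub> g)"])
        (use ig in \<open>auto simp: mult unit closed\<close>)
  qed
  have f_Bij: "f i g \<in> Bij S" if "i \<in> V" "g \<in> carrier (G i)" for i g
    using bij[OF that] by (simp add: Bij_def f_def bij_betw_restrict_eq)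
  have f_mult: "f i g \<otimes>\<^bsub>BijGroup S\<^esub> f j h = (\<lambda>s\<in>S. act i g (act j h s))"
    if "i \<in> V" "g \<in> carrier (G i)" "j \<in> V" "h \<in> carrier (G j)" for i g j h
    using that f_Bij by (auto simp: BijGroup_def compose_def f_def closed)
  have "f i \<in> hom (G i) (BijGroup S)" if i: "i \<in> V" for i
  proof (rule homI)
    fix g h assume gh: "g \<in> carrier (G i)" "h \<in> carrier (G i)"
    show "f i g \<in> carrier (BijGroup S)" using f_Bij i gh by (simp add: BijGroup_def)
    show "f i (g \<otimes>\<^bsub>G i\<^esub> h) = f i g \<otimes>\<^bsub>BijGroup S\<^esub> f i h"
      unfolding f_mult[OF i gh(1) i gh(2)] using i gh by (auto simp: f_def mult)
  qed
  moreover have "f i g \<otimes>\<^bsub>BijGroup S\<^esub> f j h = f j h \<otimes>\<^bsub>BijGroup S\<^esub> f i g"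
    if "{i, j} \<in> E" "i \<in> V" "j \<in> V" "g \<in> carrier (G i)" "h \<in> carrier (G j)" for i j g h
    unfolding f_mult[OF that(2,4,3,5)] f_mult[OF that(3,5,2,4)]
    by (rule restrict_ext) (rule comm[OF that])
  ultimately obtain F where F: "F \<in> hom GP (BijGroup S)"
      "\<And>w. w \<in> words \<Longrightarrow> F (gclass w) = word_map (BijGroup S) f w"
    using graph_product_universal[OF T.group_axioms, of f] by metis
  have "word_map (BijGroup S) f x \<in> Bij S \<and>
      (\<forall>t\<in>S. word_map (BijGroup S) f x t = word_action act x t \<and> word_action act x t \<in> S)"
    if "x \<in> words" for x
    using that
  proof (induction x)
    case Nil
    have one: "word_map (BijGroup S) f [] = (\<lambda>x\<in>S. x)"
      by (simp add: BijGroup_def)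
    show ?case unfolding one by (intro conjI ballI id_Bij) simp_all
  next
    case (Cons l x)
    obtain i g where l: "l = (i, g)" by (cases l)
    have ig: "i \<in> V" "g \<in> carrier (G i)" "x \<in> words" using Cons.prems l by auto
    note IH = Cons.IH[OF ig(3)]
    let ?m = "word_map (BijGroup S) f x"
    have m: "word_map (BijGroup S) f (l # x) = compose S (f i g) ?m"
      using IH f_Bij[OF ig(1,2)] by (simp add: BijGroup_def l)
    have "f i g t = act i g t" if "t \<in> S" for t using that by (simp add: f_def)
    then show ?case
      unfolding m using IH f_Bij[OF ig(1,2)] ig closed by (auto simp: l compose_Bij compose_eq)
  qed
  then show ?thesis using F(2) uw s by metis
qed

text \<open>A vertex is exposed in a word if some letter of its group can be moved to the front by
  swaps of adjacent vertices. A further letter of that group, put in front of the word, could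
  then be merged with it.\<close>

definition exposed :: "'v \<Rightarrow> ('v \<times> 'g) list \<Rightarrow> bool" where
  "exposed i w \<longleftrightarrow> (\<exists>u g w'. w = u @ (i, g) # w' \<and> (\<forall>(j, h)\<in>set u. {i, j} \<in> E))"

fun reduced :: "('v \<times> 'g) list \<Rightarrow> bool" where
  "reduced [] \<longleftrightarrow> True"
| "reduced ((i, g) # w) \<longleftrightarrow> g \<noteq> \<one>\<^bsub>G i\<^esub> \<and> \<not> exposed i w \<and> reduced w"

lemma gclass_append_cong:
  assumes "gclass u = gclass u'" "gclass w = gclass w'" "u \<in> words" "u' \<in> words" "w \<in> words" "w' \<in> words"
  shows "gclass (u @ w) = gclass (u' @ w')"
  using assms by (simp add: gclass_mult[symmetric])

lemma gclass_move_right: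
  assumes "i \<in> V" "g \<in> carrier (G i)" "u \<in> words" "\<forall>(j, h)\<in>set u. {i, j} \<in> E"
  shows "gclass ((i, g) # u) = gclass (u @ [(i, g)])"
  using assms(3,4)
proof (induction u)
  case Nil
  then show ?case by simp
next
  case (Cons l u)
  obtain j h where l: "l = (j, h)" by (cases l)
  have jh: "j \<in> V" "h \<in> carrier (G j)" "u \<in> words" "{i, j} \<in> E" using Cons.prems l by auto
  have "gclass ([(i, g), (j, h)] @ u) = gclass ([(j, h), (i, g)] @ u)"
    using assms jh by (intro gclass_append_cong gclass_swap) auto
  also have "\<dots> = gclass ([(j, h)] @ (i, g) # u)" by simp
  also have "\<dots> = gclass ([(j, h)] @ u @ [(i, g)])"
    using Cons assms jh by (intro gclass_append_cong) auto
  finally show ?case by (simp add: l)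
qed

text \<open>An identity letter can be dropped, and a letter whose vertex is exposed in the rest of the
  word can be moved next to a letter of the same group and merged with it.\<close>

lemma shorten_unreduced:
  assumes "w \<in> words" "\<not> reduced w"
  shows "\<exists>w'\<in>words. gclass w' = gclass w \<and> length w' < length w"
  using assms
proof (induction w)
  case Nil
  then show ?case by simp
next
  case (Cons l w)
  obtain i g where l: "l = (i, g)" by (cases l)
  have ig: "i \<in> V" "g \<in> carrier (G i)" "w \<in> words" using Cons.prems l by auto
  consider "\<not> reduced w" | "g = \<one>\<^bsub>G i\<^esub>" | "exposed i w" using Cons.prems l by auto
  then show ?case
  proof cases
    case 1
    then obtain w' where w': "w' \<in> words" "gclass w' = gclass w" "length w' < length w"
      using Cons.IH ig by auto
    have "gclass ([l] @ w') = gclass ([l] @ w)"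
      using w' ig l by (intro gclass_append_cong) auto
    then show ?thesis using w' ig l by (intro bexI[of _ "l # w'"]) auto
  next
    case 2
    have "gclass ([l] @ w) = gclass ([] @ w)"
      using 2 ig l gclass_unit by (intro gclass_append_cong) auto
    then show ?thesis using ig by (intro bexI[of _ w]) auto
  next
    case 3
    then obtain u h w' where w: "w = u @ (i, h) # w'" and u: "\<forall>(j, h)\<in>set u. {i, j} \<in> E"
      by (auto simp: exposed_def)
    have wd: "u \<in> words" "h \<in> carrier (G i)" "w' \<in> words" using ig w by auto
    interpret Gi: group "G i" using ig vertex_group by simp
    have "gclass (l # w) = gclass (((i, g) # u) @ ((i, h) # w'))" by (simp add: l w)
    also have "\<dots> = gclass ((u @ [(i, g)]) @ ((i, h) # w'))"
      using ig wd u by (intro gclass_append_cong gclass_move_right) auto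
    also have "\<dots> = gclass (u @ [(i, g), (i, h)] @ w')" by simp
    also have "\<dots> = gclass (u @ [(i, g \<otimes>\<^bsub>G i\<^esub> h)] @ w')"
      using ig wd by (intro gclass_append_cong gclass_merge) auto
    finally show ?thesis
      using ig wd by (intro bexI[of _ "u @ [(i, g \<otimes>\<^bsub>G i\<^esub> h)] @ w'"]) (auto simp: w)
  qed
qed

lemma reduced_representative:
  assumes "x \<in> carrier GP"
  obtains w where "w \<in> words" "reduced w" "gclass w = x"
proof -
  have "\<exists>w. w \<in> words \<and> gclass w = x" using assms by (auto simp: carrier_GP)
  then obtain w where w: "w \<in> words \<and> gclass w = x"
      and min: "\<And>w'. w' \<in> words \<and> gclass w' = x \<Longrightarrow> length w \<le> length w'"
    using ex_has_least_nat[of "\<lambda>w. w \<in> words \<and> gclass w = x" _ length] by blast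
  then have "reduced w" using shorten_unreduced by (metis not_le)
  then show thesis using w that by blast
qed

lemma countable_GP:
  assumes "countable V" "\<And>i. i \<in> V \<Longrightarrow> countable (carrier (G i))"
  shows "countable (carrier GP)"
  unfolding carrier_GP free_product_words_def
  using assms by (intro countable_image countable_lists countable_SIGMA)

end

section \<open>Pilings\<close>

text \<open>A piling keeps one stack for each vertex. Dropping a piece at \<open>v\<close> puts a
  nonzero integer on the stack of \<open>v\<close> and a blank, written \<open>0\<close>, on the stack of every other vertex
  not adjacent to \<open>v\<close>, so that it covers exactly those with which it does not commute.
  Pieces at adjacent vertices touch different stacks or both leave blanks, so the order in
  which they fall is forgotten. An integer at \<open>v\<close> is added to the accessible piece at \<open>v\<close>,
  which is removed if it becomes \<open>0\<close>; if no piece at \<open>v\<close> is accessible, the integer is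
  dropped as a new piece. This is an action of the right-angled Artin group on the
  pilings in which no piece lies directly on another one of the same vertex.\<close>

locale pilings =
  fixes E :: "'v set set"
  assumes irrefl: "{v} \<notin> E"
begin

text \<open>The value \<open>0\<close> stands for an empty stack as well as for a blank: in both cases no piece at
  \<open>v\<close> is accessible.\<close>

definition top :: "'v \<Rightarrow> ('v \<Rightarrow> int list) \<Rightarrow> int" where
  "top v \<pi> = (case \<pi> v of [] \<Rightarrow> 0 | m # _ \<Rightarrow> m)"

definition push :: "'v \<Rightarrow> int \<Rightarrow> ('v \<Rightarrow> int list) \<Rightarrow> ('v \<Rightarrow> int list)" where
  "push v m \<pi> = (\<lambda>u. if u = v then m # \<pi> v else if {v, u} \<in> E then \<pi> u else 0 # \<pi> u)"

definition pop :: "'v \<Rightarrow> ('v \<Rightarrow> int list) \<Rightarrow> ('v \<Rightarrow> int list)" where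
  "pop v \<pi> = (\<lambda>u. if {v, u} \<in> E then \<pi> u else tl (\<pi> u))"

inductive_set valid :: "('v \<Rightarrow> int list) set" where
  empty: "(\<lambda>_. []) \<in> valid"
| push: "\<pi> \<in> valid \<Longrightarrow> top v \<pi> = 0 \<Longrightarrow> m \<noteq> 0 \<Longrightarrow> push v m \<pi> \<in> valid"

text \<open>A piece with exponent \<open>0\<close> is no piece. With this convention every valid piling is uniquely
  of the form \<open>put v m \<sigma>\<close> with nothing accessible at \<open>v\<close> in \<open>\<sigma>\<close>, and
  \<open>act v\<close> is translation in \<open>m\<close>.\<close>

definition put :: "'v \<Rightarrow> int \<Rightarrow> ('v \<Rightarrow> int list) \<Rightarrow> ('v \<Rightarrow> int list)" where
  "put v m \<pi> = (if m = 0 then \<pi> else push v m \<pi>)"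

definition strip :: "'v \<Rightarrow> ('v \<Rightarrow> int list) \<Rightarrow> ('v \<Rightarrow> int list)" where
  "strip v \<pi> = (if top v \<pi> = 0 then \<pi> else pop v \<pi>)"

definition act :: "'v \<Rightarrow> int \<Rightarrow> ('v \<Rightarrow> int list) \<Rightarrow> ('v \<Rightarrow> int list)" where
  "act v m \<pi> = put v (m + top v \<pi>) (strip v \<pi>)"

lemma top_push: "top u (push v m \<pi>) = (if u = v then m else if {v, u} \<in> E then top u \<pi> else 0)"
  by (simp add: top_def push_def)

lemma pop_push: "pop v (push v m \<pi>) = \<pi>"
  using irrefl[of v] by (auto simp: pop_def push_def fun_eq_iff)

lemma push_commute: "{u, v} \<in> E \<Longrightarrow> push u m (push v n \<pi>) = push v n (push u m \<pi>)"
  using irrefl[of u] by (auto simp: push_def fun_eq_iff insert_commute)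

lemma top_put: "top v \<pi> = 0 \<Longrightarrow> top v (put v m \<pi>) = m"
  by (simp add: put_def top_push)

lemma top_put_adjacent: "{u, v} \<in> E \<Longrightarrow> top u (put v m \<pi>) = top u \<pi>"
  using irrefl[of u] by (auto simp: put_def top_push insert_commute)

lemma strip_put: "top v \<pi> = 0 \<Longrightarrow> strip v (put v m \<pi>) = \<pi>"
  by (simp add: put_def strip_def top_push pop_push)

lemma put_commute: "{u, v} \<in> E \<Longrightarrow> put u m (put v n \<pi>) = put v n (put u m \<pi>)"
  by (auto simp: put_def intro: push_commute)

lemma put_valid: "\<pi> \<in> valid \<Longrightarrow> top v \<pi> = 0 \<Longrightarrow> put v m \<pi> \<in> valid"
  by (simp add: put_def valid.push)

text \<open>This coordinate system reduces all laws of the action to addition of integers. By induction on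
  the piling: if the last piece lies at another vertex and a piece at \<open>v\<close> is still accessible, then
  the two vertices are adjacent, and the pieces can be dropped in the other order.\<close>

lemma valid_decompose:
  assumes "\<pi> \<in> valid"
  obtains \<sigma> where "\<sigma> \<in> valid" "top v \<sigma> = 0" "\<pi> = put v (top v \<pi>) \<sigma>"
proof -
  have "\<exists>\<sigma>\<in>valid. top v \<sigma> = 0 \<and> \<pi> = put v (top v \<pi>) \<sigma>" using assms
  proof induction
    case empty
    then show ?case by (intro bexI[of _ "\<lambda>_. []"]) (auto simp: top_def put_def valid.empty)
  next
    case (push \<pi> w m)
    then obtain \<sigma> where \<sigma>: "\<sigma> \<in> valid" "top v \<sigma> = 0" "\<pi> = put v (top v \<pi>) \<sigma>" by auto
    consider "w = v" | "w \<noteq> v" "{v, w} \<notin> E" | "w \<noteq> v" "{v, w} \<in> E" by blast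
    then show ?case
    proof cases
      case 1
      then show ?thesis using push by (intro bexI[of _ \<pi>]) (auto simp: top_push put_def)
    next
      case 2
      then have "top v (push w m \<pi>) = 0" by (simp add: top_push insert_commute)
      then show ?thesis
        using push by (intro bexI[of _ "push w m \<pi>"]) (auto simp: put_def valid.push)
    next
      case 3
      have "top w \<sigma> = 0"
        using push.hyps \<sigma>(3) 3 top_put_adjacent[of w v "top v \<pi>" \<sigma>] by (simp add: insert_commute)
      moreover have "push w m \<pi> = put v (top v \<pi>) (push w m \<sigma>)"
        using \<sigma>(3) 3 push_commute[of v w] by (metis put_def)
      moreover have "top v (push w m \<sigma>) = 0" "top v (push w m \<pi>) = top v \<pi>"
        using 3 \<sigma>(2) by (auto simp: top_push insert_commute)
      ultimately show ?thesis
        using \<sigma>(1) push.hyps by (intro bexI[of _ "push w m \<sigma>"]) (auto simp: valid.push)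
    qed
  qed
  then show thesis using that by blast
qed

lemma act_put: "top v \<sigma> = 0 \<Longrightarrow> act v m (put v n \<sigma>) = put v (m + n) \<sigma>"
  by (simp add: act_def top_put strip_put)

lemma act_valid:
  assumes "\<pi> \<in> valid"
  shows "act v m \<pi> \<in> valid"
  using valid_decompose[OF assms, of v] by (metis act_put put_valid)

lemma act_zero:
  assumes "\<pi> \<in> valid"
  shows "act v 0 \<pi> = \<pi>"
  using valid_decompose[OF assms, of v] by (metis act_put add_0)

lemma act_add:
  assumes "\<pi> \<in> valid"
  shows "act v m (act v n \<pi>) = act v (m + n) \<pi>"
  using valid_decompose[OF assms, of v] by (metis act_put add.assoc)

text \<open>For adjacent vertices the piling can be written as \<open>put u a (put v b \<sigma>)\<close> with
  neither vertex accessible in \<open>\<sigma>\<close>; the two actions then change \<open>a\<close> and \<open>b\<close>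
  independently.\<close>

lemma act_commute:
  assumes uv: "{u, v} \<in> E" and "\<pi> \<in> valid"
  shows "act u m (act v n \<pi>) = act v n (act u m \<pi>)"
proof -
  obtain \<rho> where \<rho>: "\<rho> \<in> valid" "top u \<rho> = 0" "\<pi> = put u (top u \<pi>) \<rho>"
    using assms(2) valid_decompose by blast
  obtain \<sigma> where \<sigma>: "\<sigma> \<in> valid" "top v \<sigma> = 0" "\<rho> = put v (top v \<rho>) \<sigma>"
    using \<rho>(1) valid_decompose by blast
  have vu: "{v, u} \<in> E" using uv by (simp add: insert_commute)
  have u0: "top u \<sigma> = 0" using \<rho>(2) \<sigma>(3) top_put_adjacent[OF uv] by metis
  define a b where "a = top u \<pi>" and "b = top v \<rho>"
  have \<pi>: "\<pi> = put u a (put v b \<sigma>)" using \<rho>(3) \<sigma>(3) by (simp add: a_def b_def)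
  have tops: "top u (put v k \<sigma>) = 0" "top v (put u k \<sigma>) = 0" for k
    using u0 \<sigma>(2) uv vu by (simp_all add: top_put_adjacent)
  have "act u m (act v n \<pi>) = act u m (act v n (put v b (put u a \<sigma>)))"
    by (simp only: \<pi> put_commute[OF uv])
  also have "\<dots> = act u m (put u a (put v (n + b) \<sigma>))"
    by (simp only: act_put[OF tops(2)] put_commute[OF uv])
  also have "\<dots> = put u (m + a) (put v (n + b) \<sigma>)"
    by (rule act_put[OF tops(1)])
  also have "\<dots> = put v (n + b) (put u (m + a) \<sigma>)"
    by (rule put_commute[OF uv])
  also have "\<dots> = act v n (put v b (put u (m + a) \<sigma>))"
    by (rule act_put[OF tops(2), symmetric])
  also have "put v b (put u (m + a) \<sigma>) = act u m \<pi>"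
    by (simp only: \<pi> act_put[OF tops(1)]) (rule put_commute[OF uv, symmetric])
  finally show ?thesis .
qed

lemma act_push: "top v \<pi> = 0 \<Longrightarrow> m \<noteq> 0 \<Longrightarrow> act v m \<pi> = push v m \<pi>"
  by (simp add: act_def strip_def put_def)

end

section \<open>Classes of groups closed under extensions\<close>

lemma in_class_iso:
  assumes "in_class G \<C>" "G \<cong> H" "group H"
  shows "in_class H \<C>"
  using assms group.iso_sym iso_trans unfolding in_class_def by blast

text \<open>Closure under extensions is only available for groups with elements in \<open>'u\<close>. A countable
  group is copied into this infinite type along an injection, and the axiom is
  applied to the copy.\<close>

lemma extension_in_class:
  fixes \<C> :: "'u monoid \<Rightarrow> bool" and B :: "'b monoid" and Q :: "'q monoid"
  assumes ext: "closed_under_extensions \<C>" and inf: "infinite (UNIV :: 'u set)"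
    and B: "group B" "countable (carrier B)" and Q: "group Q"
    and \<phi>: "\<phi> \<in> hom B Q" "\<phi> ` carrier B = carrier Q"
    and ker: "in_class (B\<lparr>carrier := kernel B Q \<phi>\<rparr>) \<C>" and im: "in_class Q \<C>"
  shows "in_class B \<C>"
proof -
  obtain e :: "nat \<Rightarrow> 'u" where e: "inj e"
    using inf infinite_countable_subset by blast
  define h where "h = e \<circ> to_nat_on (carrier B)"
  have h: "inj_on h (carrier B)"
    unfolding h_def using B(2) e by (intro comp_inj_on inj_on_to_nat_on) (auto intro: inj_on_subset)
  define B' where "B' = image_group h B"
  define k where "k = inv_into (carrier B) h"
  have B': "group B'"
    unfolding B'_def using group.inj_imp_image_group_is_group[OF B(1) h] .
  have hB: "h \<in> iso B B'" unfolding B'_def by (rule inj_imp_image_group_iso[OF h])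
  have kB: "k \<in> iso B' B" unfolding k_def using group.iso_set_sym[OF B(1) hB] .
  define A where "A = kernel B' Q (\<phi> \<circ> k)"
  have \<psi>: "\<phi> \<circ> k \<in> hom B' Q"
    using kB \<phi>(1) hom_compose unfolding iso_def by blast
  then interpret \<psi>: group_hom B' Q "\<phi> \<circ> k"
    using B' Q by (simp add: group_hom_def group_hom_axioms_def)
  have kim: "k ` carrier B' = carrier B" using kB by (auto simp: iso_def bij_betw_def)
  have surj: "(\<phi> \<circ> k) ` carrier B' = carrier Q"
    using kim \<phi>(2) by (metis image_comp)
  have A: "A \<lhd> B'" unfolding A_def by (rule \<psi>.normal_kernel)
  have "B' Mod A \<cong> Q"
    using \<psi>.FactGroup_iso_set[OF surj] unfolding A_def is_iso_def by blast
  then have quot: "in_class (B' Mod A) \<C>"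
    using in_class_iso[OF im] group.iso_sym normal.factorgroup_is_group[OF A] by blast
  have kA: "k ` A = kernel B Q \<phi>"
    using kim by (auto simp: A_def kernel_def)
  have "k \<in> iso (B'\<lparr>carrier := A\<rparr>) (B\<lparr>carrier := kernel B Q \<phi>\<rparr>)"
    using kB kA inj_on_subset[of k "carrier B'" A]
    by (auto simp: iso_def hom_def bij_betw_def A_def kernel_def)
  then have "B'\<lparr>carrier := A\<rparr> \<cong> B\<lparr>carrier := kernel B Q \<phi>\<rparr>" by (auto simp: is_iso_def)
  moreover have "group (B'\<lparr>carrier := A\<rparr>)"
    using A B' by (simp add: group.subgroup_imp_group normal_imp_subgroup)
  ultimately have "in_class (B'\<lparr>carrier := A\<rparr>) \<C>"
    using in_class_iso[OF ker] group.iso_sym by blast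
  then have "in_class B' \<C>"
    using ext A B' quot unfolding closed_under_extensions_def by blast
  then show ?thesis
    using in_class_iso kB B(1) unfolding is_iso_def by blast
qed

lemma vertex_groups_integer: "vertex_groups V (\<lambda>_. integer_group)"
  by (simp add: vertex_groups_def)

lemma finitely_generated_RAAG:
  assumes "finite V"
  shows "finitely_generated (right_angled_Artin_group V E)"
proof -
  interpret A: vertex_groups V E "\<lambda>_. integer_group" by (rule vertex_groups_integer)
  interpret GP: group A.GP by (rule A.group_GP)
  let ?S = "(\<lambda>v. A.gclass [(v, 1)]) ` V"
  have S: "?S \<subseteq> carrier A.GP" by (auto intro: A.gclass_closed)
  interpret H: subgroup "generate A.GP ?S" A.GP by (rule GP.generate_is_subgroup[OF S])
  have nat: "A.gclass [(v, int n)] \<in> generate A.GP ?S" if v: "v \<in> V" for v n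
  proof (induction n)
    case 0
    then show ?case using A.gclass_unit[OF v] A.one_GP H.one_closed by simp
  next
    case (Suc n)
    have "A.gclass [(v, 1)] \<in> generate A.GP ?S" using v by (auto intro: generate.incl)
    then have "A.gclass [(v, 1)] \<otimes>\<^bsub>A.GP\<^esub> A.gclass [(v, int n)] \<in> generate A.GP ?S"
      using Suc by (rule H.m_closed)
    then show ?case using v A.gclass_merge[of v 1 "int n"] by (simp add: A.gclass_mult)
  qed
  have int: "A.gclass [(v, m)] \<in> generate A.GP ?S" if v: "v \<in> V" for v m
  proof (cases "m \<ge> 0")
    case True
    then show ?thesis using nat[OF v, of "nat m"] by simp
  next
    case False
    let ?x = "A.gclass [(v, m)]" and ?y = "A.gclass [(v, - m)]"
    have "?x \<otimes>\<^bsub>A.GP\<^esub> ?y = \<one>\<^bsub>A.GP\<^esub>"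
      using v A.gclass_merge[of v m "- m"] A.gclass_unit[OF v] by (simp add: A.gclass_mult A.one_GP)
    then have "inv\<^bsub>A.GP\<^esub> ?y = ?x"
      using v by (intro GP.inv_equality) (auto intro: A.gclass_closed)
    moreover have "?y \<in> generate A.GP ?S" using nat[OF v, of "nat (- m)"] False by simp
    ultimately show ?thesis using H.m_inv_closed by metis
  qed
  have "A.gclass w \<in> generate A.GP ?S" if "w \<in> A.words" for w
    using that
  proof (induction w)
    case Nil
    then show ?case using A.one_GP H.one_closed by simp
  next
    case (Cons l w)
    obtain v m where l: "l = (v, m)" by (cases l)
    have "A.gclass ([l] @ w) \<in> generate A.GP ?S"
      using Cons l int[of v m] by (subst A.gclass_mult[symmetric]) auto
    then show ?case by simp
  qed
  then have "generate A.GP ?S = carrier A.GP"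
    using H.subset by (auto simp: A.carrier_GP)
  then show ?thesis
    using S assms unfolding finitely_generated_def right_angled_Artin_group_def
    by (intro exI[of _ ?S]) simp
qed

text \<open>Finiteness of the graph makes the right-angled Artin group finitely generated, as is
  required of the groups whose subgroups the class is assumed to contain.\<close>

lemma embeds_in_RAAG_in_class:
  fixes V :: "nat set" and K :: "'k monoid"
  assumes P1: "contains_subgroups_of_RAAGs \<C>"
    and V: "finite V" "simplicial_graph V E" and K: "group K"
    and f: "f \<in> hom K (right_angled_Artin_group V E)" "inj_on f (carrier K)"
  shows "in_class K \<C>"
proof -
  let ?A = "right_angled_Artin_group V E"
  interpret A: vertex_groups V E "\<lambda>_. integer_group" by (rule vertex_groups_integer)
  have grp: "group ?A" using A.group_GP by (simp add: right_angled_Artin_group_def)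
  interpret f: group_hom K ?A f
    using K grp f by (simp add: group_hom_def group_hom_axioms_def)
  have "in_class (?A\<lparr>carrier := f ` carrier K\<rparr>) \<C>"
    using P1 V finitely_generated_RAAG[OF V(1)] f.img_is_subgroup
    unfolding contains_subgroups_of_RAAGs_def by blast
  moreover have "f \<in> iso K (?A\<lparr>carrier := f ` carrier K\<rparr>)"
    using f by (auto simp: iso_def hom_def bij_betw_def)
  moreover have "group (?A\<lparr>carrier := f ` carrier K\<rparr>)"
    using grp f.img_is_subgroup by (rule group.subgroup_imp_group)
  ultimately show ?thesis
    using in_class_iso K group.iso_sym unfolding is_iso_def by blast
qed

lemma trivial_group_in_class:
  assumes "contains_subgroups_of_RAAGs \<C>" "trivial_group K"
  shows "in_class K \<C>"
proof -
  let ?A = "right_angled_Artin_group ({} :: nat set) {}"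
  interpret A: vertex_groups "{} :: nat set" "{}" "\<lambda>_. integer_group" by (rule vertex_groups_integer)
  interpret A: group ?A using A.group_GP by (simp add: right_angled_Artin_group_def)
  have "(\<lambda>_. \<one>\<^bsub>?A\<^esub>) \<in> hom K ?A" by (simp add: hom_def)
  moreover have "inj_on (\<lambda>_. \<one>\<^bsub>?A\<^esub>) (carrier K)"
    using assms(2) by (auto simp: trivial_group_def)
  moreover have "simplicial_graph ({} :: nat set) {}" by (simp add: simplicial_graph_def)
  ultimately show ?thesis
    using assms embeds_in_RAAG_in_class[of \<C> "{}" "{}" K] by (auto simp: trivial_group_def)
qed

text \<open>The group of a single vertex maps onto the integers, so it is an infinite group in the
  class.\<close>

lemma infinite_type_of_RAAG_class:
  fixes \<C> :: "'u monoid \<Rightarrow> bool"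
  assumes P1: "contains_subgroups_of_RAAGs \<C>"
  shows "infinite (UNIV :: 'u set)"
proof
  assume fin: "finite (UNIV :: 'u set)"
  let ?A = "right_angled_Artin_group {0 :: nat} {}"
  interpret A: vertex_groups "{0 :: nat}" "{}" "\<lambda>_. integer_group" by (rule vertex_groups_integer)
  have A: "?A = A.GP" by (simp add: right_angled_Artin_group_def)
  obtain F where F: "F \<in> hom A.GP integer_group"
      "\<And>w. w \<in> A.words \<Longrightarrow> F (A.gclass w) = A.word_map integer_group (\<lambda>_ m. m) w"
    by (rule A.graph_product_universal[OF group_integer_group, of "\<lambda>_ m. m"]) (auto simp: hom_def)
  have "m \<in> F ` carrier ?A" for m
  proof -
    have "[(0, m)] \<in> A.words" by simp
    then have "F (A.gclass [(0, m)]) = m" "A.gclass [(0, m)] \<in> carrier ?A"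
      by (simp_all add: F(2) A A.gclass_closed)
    then show ?thesis by force
  qed
  then have "infinite (carrier ?A)"
    using infinite_UNIV_int by (metis UNIV_eq_I finite_imageI)
  moreover have "in_class ?A \<C>"
    by (rule embeds_in_RAAG_in_class[OF P1, of "{0}" "{}", where f = id])
      (auto simp: simplicial_graph_def A A.group_GP hom_def)
  then obtain H :: "'u monoid" where "?A \<cong> H" by (auto simp: in_class_def)
  then obtain h where "bij_betw h (carrier ?A) (carrier H)" by (auto simp: is_iso_def iso_def)
  ultimately show False
    using fin bij_betw_finite finite_subset subset_UNIV by metis
qed

lemma countable_product_group:
  "finite V \<Longrightarrow> (\<And>i. i \<in> V \<Longrightarrow> countable (carrier (G i))) \<Longrightarrow> countable (carrier (product_group V G))"
  by (induction V rule: finite_induct) (auto simp: PiE_insert_eq)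

text \<open>Evaluation at one vertex maps the product onto that factor; the kernel is the product of the
  other factors.\<close>

lemma finite_product_in_class:
  fixes \<C> :: "'u monoid \<Rightarrow> bool" and G :: "'v \<Rightarrow> 'g monoid"
  assumes P1: "contains_subgroups_of_RAAGs \<C>" and P2: "closed_under_extensions \<C>"
    and "finite V" "\<And>i. i \<in> V \<Longrightarrow> group (G i)" "\<And>i. i \<in> V \<Longrightarrow> countable (carrier (G i))"
      "\<And>i. i \<in> V \<Longrightarrow> in_class (G i) \<C>"
  shows "in_class (product_group V G) \<C>"
  using assms(3-6)
proof (induction V rule: finite_induct)
  case empty
  then show ?case
    by (intro trivial_group_in_class[OF P1]) (simp add: trivial_product_group)
next
  case (insert v V)
  let ?B = "product_group (insert v V) G" and ?P = "product_group V G"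
  interpret Gv: group "G v" using insert by simp
  have B: "group ?B" by (rule product_group) (use insert.prems(1) in auto)
  have P: "group ?P" by (rule product_group) (use insert.prems(1) in auto)
  let ?ev = "\<lambda>x. x v"
  have ev: "?ev \<in> hom ?B (G v)" by (auto simp: hom_def)
  have surj: "?ev ` carrier ?B = carrier (G v)"
  proof
    show "carrier (G v) \<subseteq> ?ev ` carrier ?B"
    proof
      fix g assume g: "g \<in> carrier (G v)"
      have "(\<lambda>i\<in>insert v V. if i = v then g else \<one>\<^bsub>G i\<^esub>) \<in> carrier ?B"
        using g insert.prems(1) by (auto simp: group.is_monoid)
      then show "g \<in> ?ev ` carrier ?B" by (rule rev_image_eqI) simp
    qed
  qed auto
  let ?K = "?B\<lparr>carrier := kernel ?B (G v) ?ev\<rparr>"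
  have K: "group ?K"
    using B ev Gv.group_axioms group_hom.subgroup_kernel[of ?B "G v" ?ev]
    by (intro group.subgroup_imp_group) (auto simp: group_hom_def group_hom_axioms_def)
  have "(\<lambda>x. restrict x V) \<in> iso ?K ?P"
    unfolding iso_def
  proof (intro CollectI conjI)
    show "(\<lambda>x. restrict x V) \<in> hom ?K ?P"
      by (auto simp: hom_def kernel_def fun_eq_iff)
    show "bij_betw (\<lambda>x. restrict x V) (carrier ?K) (carrier ?P)"
    proof (rule bij_betw_byWitness[where f' = "\<lambda>y. y(v := \<one>\<^bsub>G v\<^esub>)"])
      show "\<forall>x\<in>carrier ?K. (restrict x V)(v := \<one>\<^bsub>G v\<^esub>) = x"
        using insert.hyps by (auto simp: kernel_def fun_eq_iff PiE_def extensional_def)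
      show "\<forall>y\<in>carrier ?P. restrict (y(v := \<one>\<^bsub>G v\<^esub>)) V = y"
        using insert.hyps by (auto simp: fun_eq_iff PiE_def extensional_def)
      show "(\<lambda>x. restrict x V) ` carrier ?K \<subseteq> carrier ?P"
        by (auto simp: kernel_def)
      show "(\<lambda>y. y(v := \<one>\<^bsub>G v\<^esub>)) ` carrier ?P \<subseteq> carrier ?K"
        by (auto simp: kernel_def PiE_def extensional_def)
    qed
  qed
  then have "?P \<cong> ?K" using group.iso_sym[OF K] by (auto simp: is_iso_def)
  moreover have "in_class ?P \<C>"
    using insert.IH insert.prems by simp
  ultimately have "in_class ?K \<C>"
    using K by (metis in_class_iso)
  moreover have "countable (carrier ?B)"
    using insert.hyps(1) insert.prems(2) by (intro countable_product_group) auto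
  moreover have "in_class (G v) \<C>" using insert.prems(3) by simp
  ultimately show ?case
    using extension_in_class[OF P2 infinite_type_of_RAAG_class[OF P1] B _ Gv.group_axioms ev surj]
    by simp
qed

section \<open>The kernel of the map to the direct product\<close>

text \<open>The class is only assumed to contain subgroups of right-angled Artin groups whose vertices
  are natural numbers, hence the renaming of the vertices by \<open>name\<close>. The injections \<open>enum i\<close>
  turn letters of the vertex groups into exponents.\<close>

locale enumerated_graph_product = vertex_groups V E G
  for V :: "'v set" and E :: "'v set set" and G :: "'v \<Rightarrow> 'g monoid" +
  fixes name :: "'v \<Rightarrow> nat" and enum :: "'v \<Rightarrow> 'g \<Rightarrow> int"
  assumes graph: "simplicial_graph V E"
    and inj_name: "inj_on name V"
    and inj_enum: "i \<in> V \<Longrightarrow> inj_on (enum i) (carrier (G i))"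
begin

abbreviation V' :: "nat set" where "V' \<equiv> name ` V"
abbreviation E' :: "nat set set" where "E' \<equiv> (`) name ` E"
abbreviation P :: "('v \<Rightarrow> 'g) monoid" where "P \<equiv> product_group V G"

lemma named_edge_iff: "i \<in> V \<Longrightarrow> j \<in> V \<Longrightarrow> {name i, name j} \<in> E' \<longleftrightarrow> {i, j} \<in> E"
proof
  assume ij: "i \<in> V" "j \<in> V" "{name i, name j} \<in> E'"
  then obtain e where e: "e \<in> E" "name ` {i, j} = name ` e" by auto
  then have "e \<subseteq> V" using graph by (auto simp: simplicial_graph_def)
  then have "{i, j} = e"
    using inj_on_image_eq_iff[OF inj_name, of "{i, j}" e] ij e by auto
  then show "{i, j} \<in> E" using e by simp
next
  assume "{i, j} \<in> E"
  then show "{name i, name j} \<in> E'" by (metis image_empty image_eqI image_insert)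
qed

lemma simplicial_named: "simplicial_graph V' E'"
  using graph inj_name
  by (auto simp: simplicial_graph_def card_image inj_on_subset)

sublocale A: vertex_groups V' E' "\<lambda>_. integer_group"
  by (rule vertex_groups_integer)

sublocale A: pilings E'
proof
  fix v :: nat
  have "card {v} \<noteq> 2" by simp
  then show "{v} \<notin> E'" using simplicial_named unfolding simplicial_graph_def by blast
qed

sublocale A: group A.GP by (rule A.group_GP)

sublocale P: group P by (rule product_group) (rule vertex_group)

definition letter :: "'v \<Rightarrow> int \<Rightarrow> (nat \<times> int) list set set" where
  "letter i m = A.gclass [(name i, m)]"

lemma letter_closed [simp]: "i \<in> V \<Longrightarrow> letter i m \<in> carrier A.GP"
  unfolding letter_def by (rule A.gclass_closed) simp

lemma letter_zero: "i \<in> V \<Longrightarrow> letter i 0 = \<one>\<^bsub>A.GP\<^esub>"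
  using A.gclass_unit[of "name i"] by (simp add: letter_def A.one_GP)

lemma letter_add: "i \<in> V \<Longrightarrow> letter i m \<otimes>\<^bsub>A.GP\<^esub> letter i n = letter i (m + n)"
  using A.gclass_merge[of "name i" m n] by (simp add: letter_def A.gclass_mult)

lemma letter_commute:
  assumes "i \<in> V" "j \<in> V" "{i, j} \<in> E"
  shows "letter i m \<otimes>\<^bsub>A.GP\<^esub> letter j n = letter j n \<otimes>\<^bsub>A.GP\<^esub> letter i m"
  using A.gclass_swap[of "name i" "name j" m n] assms named_edge_iff
  by (simp add: letter_def A.gclass_mult)

text \<open>The action of \<open>G i\<close> on pairs of an element of the Artin group and a point of
  the product. It is the translation \<open>(b, p) \<mapsto> (b, p(i := g p i))\<close>, conjugated by the bijection
  that multiplies \<open>b\<close> on the left by \<open>letter i (enum i (p i))\<close>.\<close>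

definition step :: "'v \<Rightarrow> 'g \<Rightarrow> (nat \<times> int) list set set \<times> ('v \<Rightarrow> 'g) \<Rightarrow>
    (nat \<times> int) list set set \<times> ('v \<Rightarrow> 'g)" where
  "step i g = (\<lambda>(b, p).
    (letter i (enum i (g \<otimes>\<^bsub>G i\<^esub> p i) - enum i (p i)) \<otimes>\<^bsub>A.GP\<^esub> b, p(i := g \<otimes>\<^bsub>G i\<^esub> p i)))"

lemma step_Pair: "step i g (b, p) =
    (letter i (enum i (g \<otimes>\<^bsub>G i\<^esub> p i) - enum i (p i)) \<otimes>\<^bsub>A.GP\<^esub> b, p(i := g \<otimes>\<^bsub>G i\<^esub> p i))"
  by (simp add: step_def)

abbreviation states :: "((nat \<times> int) list set set \<times> ('v \<Rightarrow> 'g)) set" where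
  "states \<equiv> carrier A.GP \<times> carrier P"

abbreviation run where "run \<equiv> word_action step"

lemma step_closed:
  assumes "i \<in> V" "g \<in> carrier (G i)" "s \<in> states"
  shows "step i g s \<in> states"
proof -
  interpret Gi: group "G i" using assms vertex_group by simp
  obtain b p where s: "s = (b, p)" by (cases s)
  have "p i \<in> carrier (G i)" using assms s by auto
  then show ?thesis
    using assms by (auto simp: step_Pair s PiE_def extensional_def)
qed

lemma step_unit:
  assumes "i \<in> V" "s \<in> states"
  shows "step i \<one>\<^bsub>G i\<^esub> s = s"
proof -
  interpret Gi: group "G i" using assms vertex_group by simp
  obtain b p where s: "s = (b, p)" by (cases s)
  have "p i \<in> carrier (G i)" using assms s by auto
  then show ?thesis using assms by (simp add: step_Pair s letter_zero)
qed

lemma step_mult: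
  assumes "i \<in> V" "g \<in> carrier (G i)" "h \<in> carrier (G i)" "s \<in> states"
  shows "step i g (step i h s) = step i (g \<otimes>\<^bsub>G i\<^esub> h) s"
proof -
  interpret Gi: group "G i" using assms vertex_group by simp
  obtain b p where s: "s = (b, p)" by (cases s)
  have "p i \<in> carrier (G i)" using assms s by auto
  then show ?thesis
    using assms by (simp add: step_Pair s Gi.m_assoc A.m_assoc[symmetric] letter_add)
qed

lemma step_commute:
  assumes "{i, j} \<in> E" "i \<in> V" "j \<in> V" "s \<in> states"
  shows "step i g (step j h s) = step j h (step i g s)"
proof -
  have "card {i, j} = 2" using graph assms(1) by (auto simp: simplicial_graph_def)
  then have "i \<noteq> j" by auto
  moreover obtain b p where s: "s = (b, p)" by (cases s)
  ultimately show ?thesis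
    using assms letter_commute[OF assms(2,3,1)]
    by (simp add: step_Pair A.m_assoc[symmetric] fun_upd_twist)
qed

lemma run_well_defined:
  "u \<in> words \<Longrightarrow> w \<in> words \<Longrightarrow> gclass u = gclass w \<Longrightarrow> s \<in> states \<Longrightarrow> run u s = run w s"
  by (rule word_action_well_defined[where S = states])
    (assumption | rule step_closed step_unit step_mult step_commute)+

lemma run_closed: "w \<in> words \<Longrightarrow> s \<in> states \<Longrightarrow> run w s \<in> states"
proof (induction w)
  case (Cons l w)
  then show ?case by (cases l) (auto intro!: step_closed simp del: carrier_product_group)
qed simp

text \<open>Letters act by left multiplication on both components, with exponents that depend on the
  point of the product alone. So the action commutes with right multiplication by elements
  of the Artin group, and in the second component with right multiplication in the product. These
  two facts turn the orbit map of \<open>(1, 1)\<close> into homomorphisms.\<close>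

lemma run_mult_right:
  assumes "w \<in> words" "b \<in> carrier A.GP" "b' \<in> carrier A.GP" "p \<in> carrier P"
  shows "run w (b \<otimes>\<^bsub>A.GP\<^esub> b', p) = (fst (run w (b, p)) \<otimes>\<^bsub>A.GP\<^esub> b', snd (run w (b, p)))"
  using assms(1)
proof (induction w)
  case (Cons l w)
  obtain i g where l: "l = (i, g)" by (cases l)
  obtain c q where cq: "run w (b, p) = (c, q)" by (cases "run w (b, p)")
  have "run w (b, p) \<in> states" using Cons.prems assms l by (intro run_closed) auto
  then show ?case
    using Cons assms l cq by (simp add: step_Pair A.m_assoc del: fun_upd_apply)
qed simp

lemma run_product_coordinate:
  assumes "w \<in> words" "p \<in> carrier P" "p' \<in> carrier P" "b \<in> carrier A.GP" "b' \<in> carrier A.GP"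
  shows "snd (run w (b, p \<otimes>\<^bsub>P\<^esub> p')) = snd (run w (b', p)) \<otimes>\<^bsub>P\<^esub> p'"
  using assms(1)
proof (induction w)
  case (Cons l w)
  obtain i g where l: "l = (i, g)" by (cases l)
  have ig: "i \<in> V" "g \<in> carrier (G i)" "w \<in> words" using Cons.prems l by auto
  interpret Gi: group "G i" using ig vertex_group by simp
  obtain c q where cq: "run w (b', p) = (c, q)" by (cases "run w (b', p)")
  obtain c' q' where cq': "run w (b, p \<otimes>\<^bsub>P\<^esub> p') = (c', q')"
    by (cases "run w (b, p \<otimes>\<^bsub>P\<^esub> p')")
  have "run w (b', p) \<in> states" using ig assms by (intro run_closed) auto
  then have "q i \<in> carrier (G i)" "p' i \<in> carrier (G i)"
    using assms ig by (auto simp: cq)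
  then have "(q \<otimes>\<^bsub>P\<^esub> p')(i := g \<otimes>\<^bsub>G i\<^esub> (q \<otimes>\<^bsub>P\<^esub> p') i) = q(i := g \<otimes>\<^bsub>G i\<^esub> q i) \<otimes>\<^bsub>P\<^esub> p'"
    using ig by (auto simp: fun_eq_iff Gi.m_assoc)
  moreover have "q' = q \<otimes>\<^bsub>P\<^esub> p'" using Cons.IH[OF ig(3)] by (simp only: cq cq' snd_conv)
  ultimately show ?case
    by (simp only: l word_action_simps cq cq' step_Pair snd_conv)
qed simp

definition start where "start = (\<one>\<^bsub>A.GP\<^esub>, \<one>\<^bsub>P\<^esub>)"

lemma start_state: "start \<in> states"
  unfolding start_def by (intro SigmaI A.one_closed P.one_closed)

definition rep where "rep x = (SOME w. w \<in> words \<and> gclass w = x)"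

definition proj where "proj x = snd (run (rep x) start)"

text \<open>Multiplicative on the kernel of \<open>proj\<close> only: in general the exponents that \<open>x\<close>
  contributes to the value at a product \<open>x y\<close> depend on the point \<open>proj y\<close>.\<close>

definition cocycle where "cocycle x = fst (run (rep x) start)"

lemma run_rep:
  assumes "w \<in> words"
  shows "run (rep (gclass w)) start = run w start"
proof -
  have "rep (gclass w) \<in> words \<and> gclass (rep (gclass w)) = gclass w"
    unfolding rep_def by (rule someI[where x = w]) (use assms in simp)
  then show ?thesis using assms start_state by (intro run_well_defined) auto
qed

lemma proj_gclass: "w \<in> words \<Longrightarrow> proj (gclass w) = snd (run w start)"
  by (simp add: proj_def run_rep)

lemma cocycle_gclass: "w \<in> words \<Longrightarrow> cocycle (gclass w) = fst (run w start)"
  by (simp add: cocycle_def run_rep)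

lemma run_start_closed:
  "w \<in> words \<Longrightarrow> fst (run w start) \<in> carrier A.GP \<and> snd (run w start) \<in> carrier P"
  using run_closed[OF _ start_state] by (simp add: mem_Times_iff)

lemma proj_hom: "proj \<in> hom GP P"
proof (rule homI)
  fix x assume "x \<in> carrier GP"
  then show "proj x \<in> carrier P"
    using run_start_closed by (auto simp: carrier_GP proj_gclass simp del: carrier_product_group)
next
  fix x y assume "x \<in> carrier GP" "y \<in> carrier GP"
  then obtain u w where uw: "u \<in> words" "w \<in> words" "x = gclass u" "y = gclass w"
    by (auto simp: carrier_GP)
  obtain c q where cq: "run w start = (c, q)" "c \<in> carrier A.GP" "q \<in> carrier P"
    using run_start_closed[OF uw(2)] by (cases "run w start") auto
  have "snd (run u (c, \<one>\<^bsub>P\<^esub> \<otimes>\<^bsub>P\<^esub> q)) = snd (run u start) \<otimes>\<^bsub>P\<^esub> q"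
    unfolding start_def using uw cq P.one_closed A.one_closed by (intro run_product_coordinate)
  moreover have "\<one>\<^bsub>P\<^esub> \<otimes>\<^bsub>P\<^esub> q = q" using cq(3) by (rule P.l_one)
  ultimately show "proj (x \<otimes>\<^bsub>GP\<^esub> y) = proj x \<otimes>\<^bsub>P\<^esub> proj y"
    using uw cq(1) by (simp add: gclass_mult proj_gclass del: mult_product_group one_product_group)
qed

text \<open>A point of the product is reached from the identity by one letter per vertex.\<close>

lemma proj_surj:
  assumes "finite V"
  shows "proj ` carrier GP = carrier P"
proof
  show "proj ` carrier GP \<subseteq> carrier P"
    using proj_hom by (auto simp: hom_def simp del: carrier_product_group)
  show "carrier P \<subseteq> proj ` carrier GP"
  proof
    fix p assume p: "p \<in> carrier P"
    obtain xs where xs: "set xs = V" "distinct xs" using assms finite_distinct_list by blast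
    have "map (\<lambda>i. (i, p i)) ys \<in> words \<and>
        snd (run (map (\<lambda>i. (i, p i)) ys) start) = (\<lambda>i\<in>V. if i \<in> set ys then p i else \<one>\<^bsub>G i\<^esub>)"
      if "set ys \<subseteq> V" "distinct ys" for ys
      using that
    proof (induction ys)
      case Nil
      then show ?case by (auto simp: start_def)
    next
      case (Cons i ys)
      interpret Gi: group "G i" using Cons.prems vertex_group by simp
      have "p i \<in> carrier (G i)" using p Cons.prems by auto
      moreover obtain c q where "run (map (\<lambda>i. (i, p i)) ys) start = (c, q)"
        by (cases "run (map (\<lambda>i. (i, p i)) ys) start")
      ultimately show ?case using Cons by (auto simp: step_Pair fun_eq_iff)
    qed
    from this[of xs] have "map (\<lambda>i. (i, p i)) xs \<in> words"
        "proj (gclass (map (\<lambda>i. (i, p i)) xs)) = (\<lambda>i\<in>V. p i)"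
      using xs by (auto simp: proj_gclass intro!: restrict_ext)
    moreover have "(\<lambda>i\<in>V. p i) = p" using p by (auto simp: PiE_def extensional_restrict)
    ultimately show "p \<in> proj ` carrier GP"
      using gclass_closed by (metis rev_image_eqI)
  qed
qed

abbreviation K where "K \<equiv> GP\<lparr>carrier := kernel GP P proj\<rparr>"

lemma group_K: "group K"
  using group_GP P.group_axioms proj_hom
  by (intro group.subgroup_imp_group group_hom.subgroup_kernel)
    (auto simp: group_hom_def group_hom_axioms_def)

lemma kernel_run:
  assumes "w \<in> words" "gclass w \<in> carrier K"
  shows "snd (run w start) = \<one>\<^bsub>P\<^esub>"
  using assms by (simp add: kernel_def proj_gclass)

lemma cocycle_hom: "cocycle \<in> hom K A.GP"
proof (rule homI)
  fix x assume "x \<in> carrier K"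
  then show "cocycle x \<in> carrier A.GP"
    using run_start_closed by (auto simp: kernel_def carrier_GP cocycle_gclass)
next
  fix x y assume xy: "x \<in> carrier K" "y \<in> carrier K"
  then obtain u w where uw: "u \<in> words" "w \<in> words" "x = gclass u" "y = gclass w"
    by (auto simp: kernel_def carrier_GP)
  obtain c where c: "run w start = (c, \<one>\<^bsub>P\<^esub>)" "c \<in> carrier A.GP"
    using run_start_closed[OF uw(2)] kernel_run[OF uw(2)] xy uw by (metis prod.collapse)
  have "run u (\<one>\<^bsub>A.GP\<^esub> \<otimes>\<^bsub>A.GP\<^esub> c, \<one>\<^bsub>P\<^esub>) = (fst (run u start) \<otimes>\<^bsub>A.GP\<^esub> c, snd (run u start))"
    unfolding start_def using uw c(2) P.one_closed A.one_closed by (intro run_mult_right)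
  then show "cocycle (x \<otimes>\<^bsub>K\<^esub> y) = cocycle x \<otimes>\<^bsub>A.GP\<^esub> cocycle y"
    using uw c by (simp add: gclass_mult cocycle_gclass)
qed

text \<open>The word in the generators of the Artin group that represents the first component of
  \<open>run w start\<close>. The current coordinates are those produced by the letters to the right,
  which act first.\<close>

fun exponents :: "('v \<times> 'g) list \<Rightarrow> (nat \<times> int) list" where
  "exponents [] = []"
| "exponents ((i, g) # w) = (let x = snd (run w start) i in
    (name i, enum i (g \<otimes>\<^bsub>G i\<^esub> x) - enum i x) # exponents w)"

lemma cocycle_exponents:
  "w \<in> words \<Longrightarrow> exponents w \<in> A.words \<and> fst (run w start) = A.gclass (exponents w)"
proof (induction w)
  case Nil
  then show ?case by (simp add: start_def A.one_GP)
next
  case (Cons l w)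
  obtain i g where l: "l = (i, g)" by (cases l)
  have ig: "i \<in> V" "w \<in> words" using Cons.prems l by auto
  moreover obtain c q where "run w start = (c, q)" by (cases "run w start")
  ultimately show ?case
    using Cons.IH by (simp add: l Let_def step_Pair letter_def A.gclass_mult)
qed

abbreviation pile :: "('v \<times> 'g) list \<Rightarrow> nat \<Rightarrow> int list" where
  "pile w \<equiv> A.word_action A.act (exponents w) (\<lambda>_. [])"

text \<open>The heart of injectivity. A letter \<open>g \<noteq> 1\<close> moves the coordinate \<open>x\<close> to a different one, so its
  exponent is nonzero; its vertex is not exposed in the rest of the word, so by induction no piece of
  that vertex is accessible, and a new piece is dropped instead of an old one being changed. A piece
  once dropped is never removed.\<close>

lemma pile_reduced:
  assumes "w \<in> words" "reduced w"
  shows "pile w \<in> A.valid \<and> (\<forall>j\<in>V. A.top (name j) (pile w) \<noteq> 0 \<longrightarrow> exposed j w) \<and>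
    (w \<noteq> [] \<longrightarrow> pile w \<noteq> (\<lambda>_. []))"
  using assms
proof (induction w)
  case Nil
  then show ?case by (simp add: A.valid.empty A.top_def)
next
  case (Cons l w)
  obtain i g where l: "l = (i, g)" by (cases l)
  have ig: "i \<in> V" "g \<in> carrier (G i)" "w \<in> words" "g \<noteq> \<one>\<^bsub>G i\<^esub>" "reduced w" "\<not> exposed i w"
    using Cons.prems l by auto
  interpret Gi: group "G i" using ig vertex_group by simp
  note IH = Cons.IH[OF ig(3,5)]
  define x where "x = snd (run w start) i"
  define n where "n = enum i (g \<otimes>\<^bsub>G i\<^esub> x) - enum i x"
  have x: "x \<in> carrier (G i)"
    using run_start_closed[OF ig(3)] ig(1) by (auto simp: x_def)
  have "g \<otimes>\<^bsub>G i\<^esub> x \<noteq> x" using ig x by (simp add: Gi.r_cancel_one)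
  then have n: "n \<noteq> 0"
    using inj_onD[OF inj_enum[OF ig(1)], of "g \<otimes>\<^bsub>G i\<^esub> x" x] ig x by (auto simp: n_def)
  have top: "A.top (name i) (pile w) = 0" using IH ig by blast
  have pile: "pile (l # w) = A.push (name i) n (pile w)"
    using A.act_push[OF top n] by (simp add: l Let_def x_def n_def)
  have "exposed j (l # w)" if j: "j \<in> V" "A.top (name j) (A.push (name i) n (pile w)) \<noteq> 0" for j
  proof (cases "j = i")
    case True
    then show ?thesis unfolding exposed_def l by (intro exI[of _ "[]"]) auto
  next
    case False
    then have "name j \<noteq> name i" using inj_name j(1) ig(1) by (auto simp: inj_on_def)
    then have "{name i, name j} \<in> E'" "A.top (name j) (pile w) \<noteq> 0"
      using j(2) by (auto simp: A.top_push split: if_splits)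
    then have "{j, i} \<in> E" "exposed j w"
      using IH j(1) ig(1) named_edge_iff by (auto simp: insert_commute)
    then obtain u h w' where "w = u @ (j, h) # w'" "\<forall>(k, h)\<in>set (l # u). {j, k} \<in> E"
      by (auto simp: exposed_def l)
    then show ?thesis unfolding exposed_def by (metis append_Cons)
  qed
  moreover have "A.push (name i) n (pile w) (name i) \<noteq> []" by (simp add: A.push_def)
  ultimately show ?case
    unfolding pile using A.valid.push[of "pile w" "name i" n] IH top n by auto
qed

lemma pile_trivial:
  assumes "w \<in> words" "fst (run w start) = \<one>\<^bsub>A.GP\<^esub>"
  shows "pile w = (\<lambda>_. [])"
proof -
  have "A.word_action A.act (exponents w) (\<lambda>_. []) = A.word_action A.act [] (\<lambda>_. [])"
  proof (rule A.word_action_well_defined[where S = A.valid])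
    show "exponents w \<in> A.words" "A.gclass (exponents w) = A.gclass []"
      using cocycle_exponents assms A.one_GP by auto
    show "A.act i m (A.act j n s) = A.act j n (A.act i m s)"
      if "{i, j} \<in> E'" "s \<in> A.valid" for i j m n s
      using that by (rule A.act_commute)
  qed (simp_all add: A.act_valid A.act_zero A.act_add A.valid.empty)
  then show ?thesis by simp
qed

lemma cocycle_inj: "inj_on cocycle (carrier K)"
proof -
  have "x = \<one>\<^bsub>K\<^esub>" if x: "x \<in> carrier K" "cocycle x = \<one>\<^bsub>A.GP\<^esub>" for x
  proof -
    have "x \<in> carrier GP" using x by (simp add: kernel_def)
    then obtain w where w: "w \<in> words" "reduced w" "gclass w = x"
      by (rule reduced_representative)
    then have "w = []" using x pile_trivial pile_reduced by (metis cocycle_gclass)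
    then show ?thesis using w by (simp add: one_GP)
  qed
  then show ?thesis
    using inj_on_one_iff'[OF cocycle_hom group_K A.group_axioms] by blast
qed

end

theorem corollary1p6:
  fixes \<C> :: "'u monoid \<Rightarrow> bool"
    and V :: "'v set" and E :: "'v set set" and G :: "'v \<Rightarrow> 'g monoid"
  assumes "group_class \<C>"
    and P1: "contains_subgroups_of_RAAGs \<C>"
    and P2: "closed_under_extensions \<C>"
    and "finite V" and "simplicial_graph V E"
    and "\<And>i. i \<in> V \<Longrightarrow> group (G i)"
    and "\<And>i. i \<in> V \<Longrightarrow> countable (carrier (G i))"
    and "\<And>i. i \<in> V \<Longrightarrow> in_class (G i) \<C>"
  shows "in_class (graph_product V E G) \<C>"
proof -
  obtain name :: "'v \<Rightarrow> nat" where name: "inj_on name V"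
    using \<open>finite V\<close> finite_imp_inj_to_nat_seg by metis
  define enum where "enum i g = int (to_nat_on (carrier (G i)) g)" for i g
  have enum: "inj_on (enum i) (carrier (G i))" if "i \<in> V" for i
    using inj_on_to_nat_on[OF assms(7)[OF that]] by (auto simp: inj_on_def enum_def)
  interpret enumerated_graph_product V E G name enum
    by (intro enumerated_graph_product.intro vertex_groups.intro enumerated_graph_product_axioms.intro)
      (use assms name enum in auto)
  have "cocycle \<in> hom K (right_angled_Artin_group V' E')"
    using cocycle_hom by (simp add: right_angled_Artin_group_def)
  then have K: "in_class K \<C>"
    using \<open>finite V\<close> simplicial_named group_K cocycle_inj
    by (intro embeds_in_RAAG_in_class[OF P1]) auto
  have "in_class P \<C>"
    by (rule finite_product_in_class[OF P1 P2]) (use assms in auto)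
  moreover have "countable (carrier GP)"
    using assms by (intro countable_GP) (auto simp: countable_finite)
  ultimately show ?thesis
    using extension_in_class[OF P2 infinite_type_of_RAAG_class[OF P1] group_GP _ P.group_axioms
        proj_hom proj_surj[OF \<open>finite V\<close>] K] by blast
qed

end
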